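(* Let $\alpha,\beta\in\,]0,1[$ be such that $\alpha+\beta<0.29$. Define $$\rho^\#=\frac{1}{2\sqrt{C(M)}}\,\frac{d^{1/4}}{\sqrt n},\qquad\text{where}\quad C(M)=1+\frac{M^2}{2}e^{M^2}.$$ Then, if $\rho<\rho^\#$, $$\inf_{\Psi_\alpha}\ \sup_{f_{(\varepsilon,\mu)}\in\mathcal F_2[M],\ \varepsilon\|\mu\|\ge\rho}\ \mathbb{P}_{f_{(\varepsilon,\mu)}}(\Psi_\alpha=0)>\beta,$$ where the infimum is taken over all level-$\alpha$ tests. In particular, this implies that $$\underline{\rho}(\mathcal F_2[M],\alpha,\beta)\ge\rho^\#.$$
   Context: Let $M>0$ be given. Let $\phi_d$ be the density of the standard Gaussian distribution $\mathcal N_d(0_d,I_d)$ on $\mathbb{R}^d$. For $\varepsilon\in\,]0,1[$ and $\mu\in\mathbb{R}^d$ put $f_{(\varepsilon,\mu)}(x)=(1-\varepsilon)\phi_d(x)+\varepsilon\phi_d(x-\mu)$. Let $\|\cdot\|$ be the Euclidean norm and $\mathcal F_2[M]=\{f_{(\varepsilon,\mu)}:\varepsilon\in\,]0,1[,\ \|\mu\|\le M\}$. One observes an i.i.d. sample $\underline X=(X_1,\dots,X_n)$ of $\mathbb{R}^d$-valued random vectors. For a density $g$ on $\mathbb{R}^d$, $\mathbb{P}_g$ is the probability when the common density of the $X_i$ is $g$; $\mathbb{P}_0:=\mathbb{P}_{\phi_d}$. A test $\Psi$ is a measurable function of $\underline X$ with values in $\{0,1\}$; it has level $\alpha$ (written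 $\Psi_\alpha$) if $\mathbb{P}_0(\Psi=1)\le\alpha$. The uniform separation of a level-$\alpha$ test $\Psi_\alpha$ is $$\rho(\Psi_\alpha,\mathcal F_2[M],\beta)=\inf\Big\{\rho>0:\ \sup_{f_{(\varepsilon,\mu)}\in\mathcal F_2[M],\ \varepsilon\|\mu\|\ge\rho}\mathbb{P}_{f_{(\varepsilon,\mu)}}(\Psi_\alpha=0)\le\beta\Big\},$$ and the $(\alpha,\beta)$-minimax separation rate is $\underline\rho(\mathcal F_2[M],\alpha,\beta)=\inf_{\Psi_\alpha}\rho(\Psi_\alpha,\mathcal F_2[M],\beta)$, the infimum being over all level-$\alpha$ tests.
   Formalization: The first claim is stated only for ρ such that some member of F_2[M] has ε‖μ‖ ≥ ρ, and the second only when ρ# ≤ M; otherwise the supremum is over an empty set (ε‖μ‖ < M always) and both claims fail. *)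

theory Defs
  imports "HOL-Probability.Probability"
begin

definition gaussian_density :: "real ^ 'd \<Rightarrow> real" where
  "gaussian_density x = (\<Prod>i\<in>UNIV. std_normal_density (x $ i))"

definition mixture_density :: "real \<Rightarrow> real ^ 'd \<Rightarrow> real ^ 'd \<Rightarrow> real" where
  "mixture_density \<epsilon> \<mu> x = (1 - \<epsilon>) * gaussian_density x + \<epsilon> * gaussian_density (x - \<mu>)"

text \<open>Classes of mixtures are represented by their sets of parameters \<open>(\<epsilon>, \<mu>)\<close>, because the
  separation condition refers to the parameters and not only to the density.\<close>

definition F2 :: "real \<Rightarrow> (real \<times> (real ^ 'd)) set" where
  "F2 M = {(\<epsilon>, \<mu>). 0 < \<epsilon> \<and> \<epsilon> < 1 \<and> norm \<mu> \<le> M}"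

definition separated :: "(real \<times> (real ^ 'd)) set \<Rightarrow> real \<Rightarrow> (real \<times> (real ^ 'd)) set" where
  "separated F \<rho> = {(\<epsilon>, \<mu>) \<in> F. \<epsilon> * norm \<mu> \<ge> \<rho>}"

definition sample_law :: "nat \<Rightarrow> (real ^ 'd \<Rightarrow> real) \<Rightarrow> (nat \<Rightarrow> real ^ 'd) measure" where
  "sample_law n g = (\<Pi>\<^sub>M i\<in>{1..n}. density lborel (\<lambda>x. ennreal (g x)))"

definition tests :: "nat \<Rightarrow> ((nat \<Rightarrow> real ^ 'd) \<Rightarrow> nat) set" where
  "tests n = (\<Pi>\<^sub>M i\<in>{1..n}. borel) \<rightarrow>\<^sub>M count_space {0, 1}"

definition level_tests :: "nat \<Rightarrow> real \<Rightarrow> ((nat \<Rightarrow> real ^ 'd) \<Rightarrow> nat) set" where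
  "level_tests n \<alpha> = {\<Psi> \<in> tests n. \<P>(x in sample_law n gaussian_density. \<Psi> x = 1) \<le> \<alpha>}"

text \<open>Suprema of probabilities and infima of separation distances are taken in the complete
  lattice \<^typ>\<open>ennreal\<close>; in particular a supremum over an empty set of alternatives is \<open>0\<close>.\<close>

definition max_type2_error ::
  "nat \<Rightarrow> (real \<times> (real ^ 'd)) set \<Rightarrow> ((nat \<Rightarrow> real ^ 'd) \<Rightarrow> nat) \<Rightarrow> real \<Rightarrow> ennreal" where
  "max_type2_error n F \<Psi> \<rho> =
     (SUP (\<epsilon>, \<mu>)\<in>separated F \<rho>. ennreal (\<P>(x in sample_law n (mixture_density \<epsilon> \<mu>). \<Psi> x = 0)))"

definition uniform_separation ::
  "nat \<Rightarrow> ((nat \<Rightarrow> real ^ 'd) \<Rightarrow> nat) \<Rightarrow> (real \<times> (real ^ 'd)) set \<Rightarrow> real \<Rightarrow> ennreal" where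
  "uniform_separation n \<Psi> F \<beta> =
     (INF \<rho>\<in>{\<rho>. \<rho> > 0 \<and> max_type2_error n F \<Psi> \<rho> \<le> ennreal \<beta>}. ennreal \<rho>)"

definition minimax_rate ::
  "nat \<Rightarrow> (real \<times> (real ^ 'd)) set \<Rightarrow> real \<Rightarrow> real \<Rightarrow> ennreal" where
  "minimax_rate n F \<alpha> \<beta> = (INF \<Psi>\<in>level_tests n \<alpha>. uniform_separation n \<Psi> F \<beta>)"

definition C_const :: "real \<Rightarrow> real" where
  "C_const M = 1 + M\<^sup>2 / 2 * exp (M\<^sup>2)"

definition rho_sharp :: "real \<Rightarrow> nat \<Rightarrow> nat \<Rightarrow> real" where
  "rho_sharp M d n = 1 / (2 * sqrt (C_const M)) * (real d powr (1 / 4) / sqrt (real n))"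

end

theory Submission imports Defs begin

text \<open>
  The bound holds because a suitable mixture of alternatives is statistically close to the null
  hypothesis. Any test that accepts the null with probability at least \<open>1 - \<alpha>\<close> then also accepts,
  on average over the mixture, with nearly that probability, and so does so under at least one
  alternative.

  The prior puts the mean at a uniformly chosen vertex of the cube inscribed in the sphere of radius
  \<open>M\<close>, that is \<open>\<mu>\<^sub>g = (M / sqrt d) \<cdot> g\<close> with \<open>g \<in> {-1, 1}\<^sup>d\<close>, and takes the
  constant weight \<open>\<epsilon> = \<rho> / M\<close>, which makes \<open>\<epsilon> \<cdot> norm \<mu>\<^sub>g = \<rho>\<close>.
  For the averaged likelihood ratio \<open>L\<close> the second moment under the null is an average over two
  independent vertices:
  \<open>E L\<^sup>2 = avg\<^sub>g\<^sub>h (1 + \<epsilon>\<^sup>2 (exp (\<mu>\<^sub>g \<bullet> \<mu>\<^sub>h) - 1))\<^sup>n\<close>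
  (\<open>has_bochner_integral_likelihood_ratio_mult\<close>). Since \<open>\<mu>\<^sub>g \<bullet> \<mu>\<^sub>h\<close> lies in
  \<open>[-M\<^sup>2, M\<^sup>2]\<close>, the quadratic Taylor remainder of \<open>exp\<close> is absorbed in \<open>C_const M\<close>, and
  \<open>\<rho> \<le> rho_sharp\<close> is what turns each term into at most \<open>exp (\<bar>g \<bullet> h\<bar> / (4 sqrt d))\<close>
  (\<open>sign_mean_second_moment_le\<close>). Here \<open>g \<bullet> h\<close> is a sum of \<open>d\<close> independent random signs,
  of order \<open>sqrt d\<close>, so that the average is at most \<open>2.3\<close> in every dimension
  (\<open>sum_exp_abs_sign_patterns_le\<close>).

  A second moment at most \<open>2.3\<close> costs at most \<open>2.3 / 4 = 0.575\<close> in acceptance probability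
  (\<open>average_prob_ge_second_moment\<close>), which leaves a maximal type II error of at least
  \<open>0.425 - \<alpha>\<close> for every level-\<open>\<alpha>\<close> test. This exceeds \<open>\<beta>\<close> by a margin
  independent of the test, which is why the infimum over tests is still strictly larger than
  \<open>\<beta>\<close>. The bound on the minimax rate follows: a separation \<open>\<rho>\<close> below the threshold never
  has error at most \<open>\<beta>\<close>.
\<close>

section \<open>Densities with respect to a product measure\<close>

text \<open>
  The law of an i.i.d. sample from the alternative has as density with respect to the null
  the product of the one-observation likelihood ratios; measures on a finite product are determined
  by their values on boxes, where the integral factorises.
\<close>

lemma density_PiM_prod:
  assumes I: "finite I" and N: "sigma_finite_measure N" "sigma_finite_measure (density N g)"
    and g[measurable]: "g \<in> borel_measurable N"
  shows "(\<Pi>\<^sub>M i\<in>I. density N g) = density (\<Pi>\<^sub>M i\<in>I. N) (\<lambda>x. \<Prod>i\<in>I. g (x i))"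
proof -
  interpret N: product_sigma_finite "\<lambda>_. N" by (simp add: product_sigma_finite_def N)
  interpret D: product_sigma_finite "\<lambda>_. density N g" by (simp add: product_sigma_finite_def N)
  have "density (\<Pi>\<^sub>M i\<in>I. N) (\<lambda>x. \<Prod>i\<in>I. g (x i)) = (\<Pi>\<^sub>M i\<in>I. density N g)"
  proof (rule D.PiM_eqI[OF I])
    show "sets (density (\<Pi>\<^sub>M i\<in>I. N) (\<lambda>x. \<Prod>i\<in>I. g (x i))) = sets (\<Pi>\<^sub>M i\<in>I. density N g)"
      unfolding sets_density by (intro sets_PiM_cong) auto
  next
    fix A assume "\<And>i. i \<in> I \<Longrightarrow> A i \<in> sets (density N g)"
    then have A[measurable]: "\<And>i. i \<in> I \<Longrightarrow> A i \<in> sets N" by simp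
    have box: "Pi\<^sub>E I A \<in> sets (\<Pi>\<^sub>M i\<in>I. N)" using A I by (intro sets_PiM_I_finite) auto
    have "emeasure (density (\<Pi>\<^sub>M i\<in>I. N) (\<lambda>x. \<Prod>i\<in>I. g (x i))) (Pi\<^sub>E I A)
        = (\<integral>\<^sup>+x. (\<Prod>i\<in>I. g (x i)) * indicator (Pi\<^sub>E I A) x \<partial>(\<Pi>\<^sub>M i\<in>I. N))"
      using box I by (subst emeasure_density) auto
    also have "\<dots> = (\<integral>\<^sup>+x. (\<Prod>i\<in>I. g (x i) * indicator (A i) (x i)) \<partial>(\<Pi>\<^sub>M i\<in>I. N))"
    proof (rule nn_integral_cong)
      fix x assume "x \<in> space (\<Pi>\<^sub>M i\<in>I. N)"
      then have "indicator (Pi\<^sub>E I A) x = (\<Prod>i\<in>I. indicator (A i) (x i) :: ennreal)"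
        using I by (auto simp: space_PiM PiE_iff indicator_def)
      then show "(\<Prod>i\<in>I. g (x i)) * indicator (Pi\<^sub>E I A) x
          = (\<Prod>i\<in>I. g (x i) * indicator (A i) (x i))"
        by (simp add: prod.distrib)
    qed
    also have "\<dots> = (\<Prod>i\<in>I. \<integral>\<^sup>+y. g y * indicator (A i) y \<partial>N)"
      using I by (intro N.product_nn_integral_prod) auto
    also have "\<dots> = (\<Prod>i\<in>I. emeasure (density N g) (A i))"
      by (intro prod.cong refl) (simp add: emeasure_density)
    finally show "emeasure (density (\<Pi>\<^sub>M i\<in>I. N) (\<lambda>x. \<Prod>i\<in>I. g (x i))) (Pi\<^sub>E I A)
        = (\<Prod>i\<in>I. emeasure (density N g) (A i))" .
  qed
  then show ?thesis ..
qed

section \<open>The second moment method\<close>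

text \<open>
  With \<open>L\<close> the average of the densities and \<open>a\<close> the average probability of \<open>A\<close>, the
  difference \<open>P A - a\<close> is the integral of \<open>1\<^sub>A (1 - L)\<close>. As \<open>1 - L\<close> has integral zero, it is
  also that of \<open>(1\<^sub>A - 1/2) (1 - L) \<le> \<bar>1 - L\<bar> / 2 \<le> (1 + (1 - L)\<^sup>2) / 4\<close>, whose upper bound
  integrates to a quarter of the second moment of \<open>L\<close>.
\<close>

lemma average_prob_ge_second_moment:
  fixes h :: "'s \<Rightarrow> 'a \<Rightarrow> real"
  assumes P: "prob_space P" and A[measurable]: "A \<in> sets P"
    and S: "finite S" "S \<noteq> {}"
    and h0: "\<And>s x. 0 \<le> h s x"
    and h1: "\<And>s. s \<in> S \<Longrightarrow> has_bochner_integral P (h s) 1"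
    and h2: "\<And>s t. s \<in> S \<Longrightarrow> t \<in> S \<Longrightarrow> has_bochner_integral P (\<lambda>x. h s x * h t x) (c s t)"
  shows "(\<Sum>s\<in>S. measure (density P (h s)) A) / card S
      \<ge> measure P A - (\<Sum>s\<in>S. \<Sum>t\<in>S. c s t) / (real (card S))\<^sup>2 / 4"
proof -
  interpret prob_space P by fact
  define L where "L x = (\<Sum>s\<in>S. h s x) / card S" for x
  have card: "real (card S) > 0" using S by (simp add: card_gt_0_iff)
  have meas: "measure (density P (h s)) A = (\<integral>x. h s x * indicator A x \<partial>P)" if "s \<in> S" for s
  proof -
    have int: "integrable P (h s)" using h1[OF that] by (auto simp: has_bochner_integral_iff)
    then have [measurable]: "h s \<in> borel_measurable P" by auto
    have "emeasure (density P (h s)) A = (\<integral>\<^sup>+x. ennreal (h s x * indicator A x) \<partial>P)"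
      by (subst emeasure_density) (auto intro!: nn_integral_cong simp: indicator_def)
    also have "\<dots> = ennreal (\<integral>x. h s x * indicator A x \<partial>P)"
      using h0 int by (intro nn_integral_eq_integral integrable_real_mult_indicator) auto
    finally show ?thesis
      by (simp add: measure_def h0)
  qed
  have hA: "has_bochner_integral P (\<lambda>x. h s x * indicator A x) (measure (density P (h s)) A)"
    if "s \<in> S" for s
    using h1[OF that] meas[OF that]
    by (auto simp: has_bochner_integral_iff intro!: integrable_real_mult_indicator)
  let ?a = "(\<Sum>s\<in>S. measure (density P (h s)) A) / card S"
  let ?E = "(\<Sum>s\<in>S. \<Sum>t\<in>S. c s t) / (real (card S))\<^sup>2"
  have LA: "has_bochner_integral P (\<lambda>x. L x * indicator A x) ?a"
    using has_bochner_integral_divide_zero[OF has_bochner_integral_sum[OF hA]]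
    by (simp add: L_def sum_distrib_right)
  have L1: "has_bochner_integral P L 1"
  proof -
    have "has_bochner_integral P (\<lambda>x. (\<Sum>s\<in>S. h s x) / card S) ((\<Sum>s\<in>S. 1) / card S)"
      by (intro has_bochner_integral_divide_zero has_bochner_integral_sum h1)
    then show ?thesis using card by (simp add: L_def[abs_def])
  qed
  have L2: "has_bochner_integral P (\<lambda>x. (L x)\<^sup>2) ?E"
  proof -
    have "has_bochner_integral P (\<lambda>x. (\<Sum>s\<in>S. \<Sum>t\<in>S. h s x * h t x) / (real (card S))\<^sup>2) ?E"
      by (intro has_bochner_integral_divide_zero has_bochner_integral_sum h2)
    then show ?thesis
      by (simp add: L_def power_divide power2_eq_square sum_product)
  qed
  have A1: "has_bochner_integral P (indicator A :: _ \<Rightarrow> real) (measure P A)"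
    using A by (auto simp: has_bochner_integral_iff Int_absorb1 sets.sets_into_space emeasure_eq_measure)
  have lhs: "has_bochner_integral P
      (\<lambda>x. (indicator A x - L x * indicator A x) - (1/2) * (1 - L x))
      ((measure P A - ?a) - (1/2) * (1 - 1))"
    using A1 LA L1 prob_space
    by (intro has_bochner_integral_diff has_bochner_integral_mult_right)
       (auto simp: has_bochner_integral_iff)
  have rhs: "has_bochner_integral P (\<lambda>x. ((L x)\<^sup>2 - 2 * L x + 2) / 4) ((?E - 2 * 1 + 2) / 4)"
    using L1 L2 prob_space
    by (intro has_bochner_integral_divide_zero has_bochner_integral_add has_bochner_integral_diff
          has_bochner_integral_mult_right) (auto simp: has_bochner_integral_iff)
  have le: "(indicator A x - L x * indicator A x) - (1/2) * (1 - L x) \<le> ((L x)\<^sup>2 - 2 * L x + 2) / 4" for x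
  proof (cases "x \<in> A")
    case True
    then show ?thesis using zero_le_power2[of "L x"] by (simp add: field_simps del: zero_le_power2)
  next
    case False
    have "4 * L x \<le> (L x)\<^sup>2 + 4"
      using zero_le_power2[of "L x - 2"] by (simp add: power2_diff del: zero_le_power2)
    with False show ?thesis by (simp add: field_simps)
  qed
  have "(measure P A - ?a) - (1/2) * (1 - 1) \<le> (?E - 2 * 1 + 2) / 4"
    unfolding has_bochner_integral_integral_eq[OF lhs, symmetric]
      has_bochner_integral_integral_eq[OF rhs, symmetric]
    by (intro integral_mono integrable.intros[OF lhs] integrable.intros[OF rhs] le)
  moreover have "p - e / 4 \<le> a" if "(p - a) - (1/2) * (1 - 1) \<le> (e - 2 * 1 + 2) / 4" for p a e :: real
    using that by simp
  ultimately show ?thesis by blast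
qed

section \<open>Gaussian mixtures\<close>

lemma gaussian_density_eq_exp:
  "gaussian_density (x :: real ^ 'd::finite) = (1 / sqrt (2 * pi)) ^ CARD('d) * exp (- (x \<bullet> x) / 2)"
  by (simp add: gaussian_density_def std_normal_density_def prod.distrib prod_dividef
      exp_sum[symmetric] inner_vec_def sum_negf sum_divide_distrib power2_eq_square power_one_over)

lemma gaussian_density_pos: "gaussian_density x > 0"
  by (auto simp: gaussian_density_def intro!: prod_pos normal_density_pos)

lemma borel_measurable_gaussian_density [measurable]:
  "gaussian_density \<in> borel_measurable borel"
  unfolding gaussian_density_eq_exp[abs_def] by measurable

text \<open>
  Completing the square. Divided by \<open>gaussian_density x\<close>, the product of two translates is
  again a multiple of a translate, which reduces every Gaussian moment needed below to the
  normalisation of the density.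
\<close>

lemma gaussian_density_translates_mult:
  "gaussian_density (x - \<mu>) * gaussian_density (x - \<nu>)
     = exp (\<mu> \<bullet> \<nu>) * (gaussian_density x * gaussian_density (x - (\<mu> + \<nu>)))"
proof -
  have *: "- ((x - \<mu>) \<bullet> (x - \<mu>)) / 2 + - ((x - \<nu>) \<bullet> (x - \<nu>)) / 2
      = \<mu> \<bullet> \<nu> + (- (x \<bullet> x) / 2 + - ((x - (\<mu> + \<nu>)) \<bullet> (x - (\<mu> + \<nu>))) / 2)"
    by (simp add: algebra_simps inner_commute field_simps)
  have "exp (- ((x - \<mu>) \<bullet> (x - \<mu>)) / 2) * exp (- ((x - \<nu>) \<bullet> (x - \<nu>)) / 2)
      = exp (\<mu> \<bullet> \<nu>) * (exp (- (x \<bullet> x) / 2) * exp (- ((x - (\<mu> + \<nu>)) \<bullet> (x - (\<mu> + \<nu>))) / 2))"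
    unfolding exp_add[symmetric] * ..
  then show ?thesis unfolding gaussian_density_eq_exp by (simp only: mult_ac)
qed

lemma nn_integral_gaussian_density:
  "(\<integral>\<^sup>+x. gaussian_density (x :: real ^ 'd::finite) \<partial>lborel) = 1"
proof -
  have "(\<integral>\<^sup>+x. gaussian_density (x :: real ^ 'd) \<partial>lborel)
      = (\<integral>\<^sup>+x. (\<Prod>b\<in>Basis. ennreal (std_normal_density (x \<bullet> b))) \<partial>(lborel :: (real ^ 'd) measure))"
  proof (rule nn_integral_cong)
    fix x :: "real ^ 'd"
    have "gaussian_density x = (\<Prod>b\<in>Basis. std_normal_density (x \<bullet> b))"
      by (simp add: gaussian_density_def Basis_vec_def UNION_singleton_eq_range prod.reindex
          axis_eq_axis inj_on_def cart_eq_inner_axis)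
    then show "ennreal (gaussian_density x) = (\<Prod>b\<in>Basis. ennreal (std_normal_density (x \<bullet> b)))"
      by (simp add: prod_ennreal)
  qed
  also have "\<dots> = (\<Prod>b\<in>(Basis :: (real ^ 'd) set). \<integral>\<^sup>+x. std_normal_density x \<partial>lborel)"
    by (rule nn_integral_lborel_prod) auto
  also have "\<dots> = 1"
    by (simp add: nn_integral_eq_integral)
  finally show ?thesis .
qed

lemma has_bochner_integral_gaussian_density_translate:
  fixes \<mu> :: "real ^ 'd::finite"
  shows "has_bochner_integral lborel (\<lambda>x. gaussian_density (x - \<mu>)) 1"
proof (rule has_bochner_integral_nn_integral)
  have "(\<integral>\<^sup>+x. gaussian_density (x - \<mu>) \<partial>lborel)
      = (\<integral>\<^sup>+x. gaussian_density (x - \<mu>) \<partial>distr lborel borel ((+) \<mu>))"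
    by (simp only: lborel_distr_plus)
  also have "\<dots> = (\<integral>\<^sup>+x. gaussian_density (x :: real ^ 'd) \<partial>lborel)"
    by (subst nn_integral_distr) auto
  finally show "(\<integral>\<^sup>+x. gaussian_density (x - \<mu>) \<partial>lborel) = ennreal 1"
    by (simp add: nn_integral_gaussian_density)
qed (auto intro: less_imp_le gaussian_density_pos)

abbreviation std_gaussian :: "(real ^ 'd) measure" where
  "std_gaussian \<equiv> density lborel (\<lambda>x. ennreal (gaussian_density x))"

lemma prob_space_std_gaussian: "prob_space (std_gaussian :: (real ^ 'd::finite) measure)"
  by (rule prob_spaceI) (simp add: emeasure_density nn_integral_gaussian_density)

definition likelihood_ratio :: "real \<Rightarrow> real ^ 'd \<Rightarrow> real ^ 'd \<Rightarrow> real" where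
  "likelihood_ratio \<epsilon> \<mu> x = mixture_density \<epsilon> \<mu> x / gaussian_density x"

lemma borel_measurable_mixture_density [measurable]:
  "mixture_density \<epsilon> \<mu> \<in> borel_measurable borel"
  unfolding mixture_density_def[abs_def] by measurable

lemma borel_measurable_likelihood_ratio [measurable]:
  "likelihood_ratio \<epsilon> \<mu> \<in> borel_measurable borel"
  unfolding likelihood_ratio_def[abs_def] by measurable

lemma mixture_density_nonneg:
  assumes "0 \<le> \<epsilon>" "\<epsilon> \<le> 1"
  shows "mixture_density \<epsilon> \<mu> x \<ge> 0"
  using assms gaussian_density_pos[of x] gaussian_density_pos[of "x - \<mu>"]
  by (auto simp: mixture_density_def)

lemma likelihood_ratio_nonneg:
  assumes "0 \<le> \<epsilon>" "\<epsilon> \<le> 1"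
  shows "likelihood_ratio \<epsilon> \<mu> x \<ge> 0"
  using mixture_density_nonneg[OF assms, of \<mu> x] gaussian_density_pos[of x]
  by (auto simp: likelihood_ratio_def)

lemma has_bochner_integral_likelihood_ratio:
  "has_bochner_integral std_gaussian (likelihood_ratio \<epsilon> \<mu>) 1"
proof -
  have "has_bochner_integral lborel
      (\<lambda>x. (1 - \<epsilon>) * gaussian_density (x - 0) + \<epsilon> * gaussian_density (x - \<mu>)) ((1 - \<epsilon>) * 1 + \<epsilon> * 1)"
    by (intro has_bochner_integral_add has_bochner_integral_mult_right
        has_bochner_integral_gaussian_density_translate)
  also have "(\<lambda>x. (1 - \<epsilon>) * gaussian_density (x - 0) + \<epsilon> * gaussian_density (x - \<mu>))
      = (\<lambda>x. gaussian_density x *\<^sub>R likelihood_ratio \<epsilon> \<mu> x)"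
    by (simp add: likelihood_ratio_def mixture_density_def gaussian_density_pos[THEN less_imp_neq, symmetric])
  finally show ?thesis
    using gaussian_density_pos
    by (intro has_bochner_integral_density) (auto intro: less_imp_le)
qed

text \<open>
  Expanding \<open>f\<^sub>\<mu> f\<^sub>\<nu> / \<phi>\<close> gives four Gaussian translates of total mass one, except that the
  term of weight \<open>\<epsilon>\<^sup>2\<close> carries the extra factor \<open>exp (\<mu> \<bullet> \<nu>)\<close>.
\<close>

lemma has_bochner_integral_likelihood_ratio_mult:
  fixes \<mu> \<nu> :: "real ^ 'd::finite"
  shows "has_bochner_integral std_gaussian (\<lambda>x. likelihood_ratio \<epsilon> \<mu> x * likelihood_ratio \<epsilon> \<nu> x)
     (1 + \<epsilon>\<^sup>2 * (exp (\<mu> \<bullet> \<nu>) - 1))"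
proof -
  let ?g = gaussian_density
  let ?f = "\<lambda>x. (1 - \<epsilon>)\<^sup>2 * ?g (x - 0) + ((1 - \<epsilon>) * \<epsilon>) * ?g (x - \<mu>) + ((1 - \<epsilon>) * \<epsilon>) * ?g (x - \<nu>)
    + (\<epsilon>\<^sup>2 * exp (\<mu> \<bullet> \<nu>)) * ?g (x - (\<mu> + \<nu>))"
  have "has_bochner_integral lborel ?f
      ((1 - \<epsilon>)\<^sup>2 * 1 + ((1 - \<epsilon>) * \<epsilon>) * 1 + ((1 - \<epsilon>) * \<epsilon>) * 1 + (\<epsilon>\<^sup>2 * exp (\<mu> \<bullet> \<nu>)) * 1)"
    by (intro has_bochner_integral_add has_bochner_integral_mult_right
        has_bochner_integral_gaussian_density_translate)
  also have "(1 - \<epsilon>)\<^sup>2 * 1 + ((1 - \<epsilon>) * \<epsilon>) * 1 + ((1 - \<epsilon>) * \<epsilon>) * 1 + (\<epsilon>\<^sup>2 * exp (\<mu> \<bullet> \<nu>)) * 1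
      = 1 + \<epsilon>\<^sup>2 * (exp (\<mu> \<bullet> \<nu>) - 1)"
    by (simp add: power2_eq_square algebra_simps)
  also have "?f = (\<lambda>x. ?g x *\<^sub>R (likelihood_ratio \<epsilon> \<mu> x * likelihood_ratio \<epsilon> \<nu> x))"
  proof
    fix x :: "real ^ 'd"
    have nz: "?g x \<noteq> 0" using gaussian_density_pos[of x] by simp
    have "?g x * ?f x = (1 - \<epsilon>)\<^sup>2 * (?g x * ?g x) + (1 - \<epsilon>) * \<epsilon> * (?g x * ?g (x - \<mu>))
        + (1 - \<epsilon>) * \<epsilon> * (?g x * ?g (x - \<nu>)) + \<epsilon>\<^sup>2 * (exp (\<mu> \<bullet> \<nu>) * (?g x * ?g (x - (\<mu> + \<nu>))))"
      by (simp add: algebra_simps)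
    also have "\<dots> = mixture_density \<epsilon> \<mu> x * mixture_density \<epsilon> \<nu> x"
      unfolding gaussian_density_translates_mult[symmetric] mixture_density_def
      by (simp add: power2_eq_square algebra_simps)
    finally show "?f x = ?g x *\<^sub>R (likelihood_ratio \<epsilon> \<mu> x * likelihood_ratio \<epsilon> \<nu> x)"
      using nz unfolding likelihood_ratio_def by (simp add: field_simps)
  qed
  finally show ?thesis
    using gaussian_density_pos
    by (intro has_bochner_integral_density) (auto intro: less_imp_le)
qed

lemma density_std_gaussian_likelihood_ratio:
  "density std_gaussian (\<lambda>x. ennreal (likelihood_ratio \<epsilon> \<mu> x))
     = density lborel (\<lambda>x. ennreal (mixture_density \<epsilon> \<mu> x))"
proof -
  have "ennreal (gaussian_density x) * ennreal (likelihood_ratio \<epsilon> \<mu> x)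
      = ennreal (mixture_density \<epsilon> \<mu> x)" for x
    using gaussian_density_pos[of x]
    by (simp add: likelihood_ratio_def ennreal_mult'[symmetric])
  then show ?thesis by (simp add: density_density_eq)
qed

lemma prob_space_mixture:
  assumes "0 \<le> \<epsilon>" "\<epsilon> \<le> 1"
  shows "prob_space (density lborel (\<lambda>x. ennreal (mixture_density \<epsilon> \<mu> x)))"
  unfolding density_std_gaussian_likelihood_ratio[symmetric]
proof (rule prob_spaceI)
  have "(\<integral>\<^sup>+x. likelihood_ratio \<epsilon> \<mu> x \<partial>std_gaussian) = ennreal 1"
    using has_bochner_integral_likelihood_ratio[of \<epsilon> \<mu>] likelihood_ratio_nonneg[OF assms]
    by (subst nn_integral_eq_integral) (auto simp: has_bochner_integral_iff)
  then show "emeasure (density std_gaussian (\<lambda>x. ennreal (likelihood_ratio \<epsilon> \<mu> x)))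
      (space (density std_gaussian (\<lambda>x. ennreal (likelihood_ratio \<epsilon> \<mu> x)))) = 1"
    by (simp add: emeasure_density)
qed

definition sample_likelihood_ratio :: "nat \<Rightarrow> real \<Rightarrow> real ^ 'd \<Rightarrow> (nat \<Rightarrow> real ^ 'd) \<Rightarrow> real" where
  "sample_likelihood_ratio n \<epsilon> \<mu> x = (\<Prod>i\<in>{1..n}. likelihood_ratio \<epsilon> \<mu> (x i))"

lemma sample_law_mixture:
  assumes "0 \<le> \<epsilon>" "\<epsilon> \<le> 1"
  shows "sample_law n (mixture_density \<epsilon> \<mu>)
    = density (sample_law n gaussian_density) (sample_likelihood_ratio n \<epsilon> \<mu>)"
proof -
  have "sample_law n (mixture_density \<epsilon> \<mu>)
      = (\<Pi>\<^sub>M i\<in>{1..n}. density std_gaussian (\<lambda>x. ennreal (likelihood_ratio \<epsilon> \<mu> x)))"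
    by (simp add: sample_law_def density_std_gaussian_likelihood_ratio)
  also have "\<dots> = density (\<Pi>\<^sub>M i\<in>{1..n}. std_gaussian)
      (\<lambda>x. \<Prod>i\<in>{1..n}. ennreal (likelihood_ratio \<epsilon> \<mu> (x i)))"
    by (rule density_PiM_prod)
      (auto simp: density_std_gaussian_likelihood_ratio
        intro!: prob_space_imp_sigma_finite prob_space_std_gaussian prob_space_mixture assms)
  finally show ?thesis
    by (simp add: sample_law_def sample_likelihood_ratio_def prod_ennreal likelihood_ratio_nonneg assms)
qed

lemma product_sigma_finite_std_gaussian:
  "product_sigma_finite (\<lambda>_. std_gaussian :: (real ^ 'd::finite) measure)"
  unfolding product_sigma_finite_def
  by (intro allI prob_space_imp_sigma_finite prob_space_std_gaussian)

lemma has_bochner_integral_sample_law_prod: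
  assumes "has_bochner_integral std_gaussian f a"
  shows "has_bochner_integral (sample_law n gaussian_density) (\<lambda>x. \<Prod>i\<in>{1..n}. f (x i) :: real) (a ^ n)"
proof -
  interpret product_sigma_finite "\<lambda>_. std_gaussian :: (real ^ 'a) measure"
    by (rule product_sigma_finite_std_gaussian)
  show ?thesis
    using assms product_integrable_prod[of "{1..n}" "\<lambda>_. f"] product_integral_prod[of "{1..n}" "\<lambda>_. f"]
    by (auto simp: has_bochner_integral_iff sample_law_def)
qed

section \<open>Rademacher averages\<close>

text \<open>
  The vertices of the cube, with real entries, form an extensional function space so that a
  product of sums over \<open>{-1, 1}\<close> expands into a sum over them.
\<close>

definition sign_patterns :: "('d \<Rightarrow> real) set" where
  "sign_patterns = (UNIV \<rightarrow>\<^sub>E {-1, 1})"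

lemma finite_sign_patterns: "finite (sign_patterns :: ('d::finite \<Rightarrow> real) set)"
  by (auto simp: sign_patterns_def intro!: finite_PiE)

lemma card_sign_patterns: "card (sign_patterns :: ('d::finite \<Rightarrow> real) set) = 2 ^ CARD('d)"
  by (simp add: sign_patterns_def card_PiE numeral_2_eq_2)

lemma sign_pattern_cases: "g \<in> sign_patterns \<Longrightarrow> g i = -1 \<or> g i = 1"
  by (auto simp: sign_patterns_def PiE_iff)

text \<open>
  Multiplying by the fixed pattern \<open>g\<close> only permutes the signs, so that the moment generating
  function is that of a sum of independent signs and factorises over the coordinates.
\<close>

lemma sum_exp_sign_patterns:
  fixes g :: "'d::finite \<Rightarrow> real"
  assumes "g \<in> sign_patterns"
  shows "(\<Sum>h\<in>sign_patterns. exp (t * (\<Sum>i\<in>UNIV. g i * h i))) = (2 * cosh t) ^ CARD('d)"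
proof -
  have "(\<Sum>h\<in>sign_patterns. exp (t * (\<Sum>i\<in>UNIV. g i * h i)))
      = (\<Sum>h\<in>sign_patterns. \<Prod>i\<in>UNIV. exp (t * (g i * h i)))"
    by (simp add: exp_sum sum_distrib_left)
  also have "\<dots> = (\<Prod>i\<in>UNIV. \<Sum>y\<in>{-1, 1}. exp (t * (g i * y)))"
    unfolding sign_patterns_def by (rule prod_sum_PiE[symmetric]) auto
  also have "\<dots> = (\<Prod>i\<in>(UNIV :: 'd set). 2 * cosh t)"
  proof (rule prod.cong[OF refl])
    fix i
    show "(\<Sum>y\<in>{-1, 1}. exp (t * (g i * y))) = 2 * cosh t"
      using sign_pattern_cases[OF assms, of i] by (auto simp: cosh_field_def)
  qed
  finally show ?thesis by simp
qed

lemma exp_le_quadratic: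
  fixes x :: real
  shows "exp x \<le> 1 + x + x\<^sup>2 / 2 * exp \<bar>x\<bar>"
proof -
  obtain t where t: "\<bar>t\<bar> \<le> \<bar>x\<bar>" "exp x = (\<Sum>m<2. x ^ m / fact m) + exp t / fact 2 * x ^ 2"
    using Maclaurin_exp_le[of x 2] by blast
  have "exp t * x\<^sup>2 \<le> exp \<bar>x\<bar> * x\<^sup>2" using t(1) by (intro mult_right_mono) auto
  then show ?thesis using t(2) by (simp add: numeral_2_eq_2 field_simps)
qed

text \<open>
  One factor \<open>\<bar>x\<bar>\<close> of the quadratic Taylor remainder is traded for \<open>M\<^sup>2\<close>; this is the origin
  of the constant. A bound linear in \<open>\<bar>x\<bar>\<close> is what the moment generating function of the
  random signs can handle.
\<close>

lemma exp_minus_one_le_C_const: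
  assumes "\<bar>x\<bar> \<le> M\<^sup>2"
  shows "exp x - 1 \<le> C_const M * \<bar>x\<bar>"
proof -
  have "\<bar>x\<bar> * \<bar>x\<bar> * exp \<bar>x\<bar> \<le> M\<^sup>2 * \<bar>x\<bar> * exp (M\<^sup>2)"
    using assms by (intro mult_mono) auto
  then have "exp x - 1 \<le> x + M\<^sup>2 * \<bar>x\<bar> * exp (M\<^sup>2) / 2"
    using exp_le_quadratic[of x] by (simp add: power2_eq_square)
  also have "\<dots> \<le> \<bar>x\<bar> + M\<^sup>2 * \<bar>x\<bar> * exp (M\<^sup>2) / 2" by simp
  also have "\<dots> = C_const M * \<bar>x\<bar>" by (simp add: C_const_def algebra_simps)
  finally show ?thesis .
qed

text \<open>
  The optimal exponent is \<open>t\<^sup>2 / 2\<close>; on the unit interval the Taylor bound already gives a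
  Gaussian bound with a worse constant, which the numerical margin below can afford.
\<close>

lemma cosh_le_exp_square:
  fixes t :: real
  assumes "\<bar>t\<bar> \<le> 1"
  shows "cosh t \<le> exp (3 / 2 * t\<^sup>2)"
proof -
  have "exp \<bar>t\<bar> \<le> exp 1" using assms by simp
  also have "\<dots> \<le> 3" by (rule exp_le)
  finally have "t\<^sup>2 * exp \<bar>t\<bar> \<le> t\<^sup>2 * 3" by (intro mult_left_mono) auto
  then have "cosh t \<le> 1 + 3 / 2 * t\<^sup>2"
    using exp_le_quadratic[of t] exp_le_quadratic[of "-t"] by (simp add: cosh_field_def)
  also have "\<dots> \<le> exp (3 / 2 * t\<^sup>2)" by (rule exp_ge_add_one_self)
  finally show ?thesis .
qed

text \<open>
  The scale \<open>1 / (4 sqrt d)\<close> keeps the exponential moment bounded in every dimension: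
  \<open>cosh (1 / (4 sqrt d)) ^ d \<le> exp (3 / 32)\<close>. The absolute value costs a factor two, from
  \<open>exp \<bar>z\<bar> \<le> exp z + exp (-z)\<close>.
\<close>

lemma sum_exp_abs_sign_patterns_le:
  fixes g :: "'d::finite \<Rightarrow> real"
  assumes "g \<in> sign_patterns"
  shows "(\<Sum>h\<in>sign_patterns. exp (\<bar>\<Sum>i\<in>UNIV. g i * h i\<bar> / (4 * sqrt CARD('d))))
      \<le> 2.3 * 2 ^ CARD('d)"
proof -
  let ?d = "CARD('d)" and ?t = "1 / (4 * sqrt CARD('d))"
  let ?Z = "\<lambda>h. \<Sum>i\<in>UNIV. g i * h i"
  have d: "real ?d \<ge> 1" by (simp add: Suc_leI)
  have "(\<Sum>h\<in>sign_patterns. exp (\<bar>?Z h\<bar> / (4 * sqrt ?d)))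
      \<le> (\<Sum>h\<in>sign_patterns. exp (?t * ?Z h) + exp (- ?t * ?Z h))"
  proof (rule sum_mono)
    fix h
    show "exp (\<bar>?Z h\<bar> / (4 * sqrt ?d)) \<le> exp (?t * ?Z h) + exp (- ?t * ?Z h)"
      by (cases "?Z h \<ge> 0") (auto simp: less_imp_le)
  qed
  also have "\<dots> = 2 * (2 * cosh ?t) ^ ?d"
    unfolding sum.distrib sum_exp_sign_patterns[OF assms] by simp
  also have "\<dots> = 2 * cosh ?t ^ ?d * 2 ^ ?d" by (simp add: power_mult_distrib)
  also have "\<dots> \<le> 2.3 * 2 ^ ?d"
  proof (rule mult_right_mono)
    have "sqrt ?d \<ge> 1" using d by simp
    then have "1 \<le> 4 * sqrt ?d" by linarith
    then have "?t \<le> 1" by simp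
    then have "cosh ?t ^ ?d \<le> exp (3 / 2 * ?t\<^sup>2) ^ ?d"
      by (intro power_mono cosh_le_exp_square) (auto simp: cosh_real_nonneg)
    also have "\<dots> = exp (3 / 32)"
      using d by (simp add: exp_of_nat_mult[symmetric] power_divide power_mult_distrib)
    also have "\<dots> \<le> 1.15" using exp_bound[of "3/32 :: real"] by (simp add: power2_eq_square)
    finally show "2 * cosh ?t ^ ?d \<le> 2.3" by simp
  qed simp
  finally show ?thesis .
qed

section \<open>The least favourable prior\<close>

definition sign_mean :: "real \<Rightarrow> ('d::finite \<Rightarrow> real) \<Rightarrow> real ^ 'd" where
  "sign_mean r g = (\<chi> i. r / sqrt CARD('d) * g i)"

lemma inner_sign_mean:
  "sign_mean r g \<bullet> sign_mean r (h :: 'd::finite \<Rightarrow> real)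
     = r\<^sup>2 / CARD('d) * (\<Sum>i\<in>UNIV. g i * h i)"
proof -
  have "r / sqrt CARD('d) * g i * (r / sqrt CARD('d) * h i) = r\<^sup>2 / CARD('d) * (g i * h i)" for i
    by (simp add: power2_eq_square)
  then have "(\<Sum>i\<in>UNIV. r / sqrt CARD('d) * g i * (r / sqrt CARD('d) * h i))
      = (\<Sum>i\<in>UNIV. r\<^sup>2 / CARD('d) * (g i * h i))"
    by (intro sum.cong refl)
  then show ?thesis unfolding sum_distrib_left by (simp only: sign_mean_def inner_vec_def vec_lambda_beta inner_real_def)
qed

lemma norm_sign_mean:
  assumes "g \<in> sign_patterns" "r \<ge> 0"
  shows "norm (sign_mean r (g :: 'd::finite \<Rightarrow> real)) = r"
proof -
  have "g i * g i = 1" for i using sign_pattern_cases[OF assms(1), of i] by auto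
  then show ?thesis using assms(2) by (simp add: norm_eq_sqrt_inner inner_sign_mean)
qed

lemma C_const_ge_1: "C_const M \<ge> 1"
  by (simp add: C_const_def)

lemma rho_sharp_pos: "n \<ge> 1 \<Longrightarrow> d \<ge> 1 \<Longrightarrow> rho_sharp M d n > 0"
  using C_const_ge_1[of M] by (auto simp: rho_sharp_def)

text \<open>
  The only property of the threshold that the second moment bound uses: it cancels the sample
  size and the constant and leaves the natural scale of a sum of signs.
\<close>

lemma rho_sharp_square:
  assumes "n \<ge> 1"
  shows "n * C_const M * (rho_sharp M d n)\<^sup>2 = sqrt d / 4"
proof -
  have "(real d powr (1/4))\<^sup>2 = sqrt d"
    by (cases "d = 0") (auto simp: powr_half_sqrt[symmetric] powr_power)
  then show ?thesis
    using assms C_const_ge_1[of M]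
    by (simp add: rho_sharp_def power_mult_distrib power_divide field_simps)
qed

text \<open>
  The argument is \<open>(1 + y)\<^sup>n \<le> exp (n y)\<close> followed by the linear bound on
  \<open>exp (\<mu>\<^sub>g \<bullet> \<mu>\<^sub>h) - 1\<close>; the factor \<open>M\<^sup>2\<close> of the inner product joins \<open>\<epsilon>\<^sup>2\<close> to form
  the squared separation \<open>(\<epsilon> M)\<^sup>2\<close>.
\<close>

lemma sign_mean_second_moment_le:
  fixes g h :: "'d::finite \<Rightarrow> real"
  assumes g: "g \<in> sign_patterns" and h: "h \<in> sign_patterns"
    and M: "M > 0" and n: "n \<ge> 1" and \<epsilon>: "0 \<le> \<epsilon>" "\<epsilon> \<le> 1"
    and \<rho>: "\<epsilon> * M \<le> rho_sharp M CARD('d) n"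
  shows "(1 + \<epsilon>\<^sup>2 * (exp (sign_mean M g \<bullet> sign_mean M h) - 1)) ^ n
      \<le> exp (\<bar>\<Sum>i\<in>UNIV. g i * h i\<bar> / (4 * sqrt CARD('d)))"
proof -
  let ?x = "sign_mean M g \<bullet> sign_mean M h" and ?Z = "\<Sum>i\<in>UNIV. g i * h i" and ?d = "real CARD('d)"
  have d: "?d > 0" by simp
  have "\<bar>?x\<bar> \<le> M\<^sup>2"
    using Cauchy_Schwarz_ineq2[of "sign_mean M g" "sign_mean M h"] M
    by (simp add: norm_sign_mean g h power2_eq_square)
  then have "\<epsilon>\<^sup>2 * (exp ?x - 1) \<le> \<epsilon>\<^sup>2 * (C_const M * \<bar>?x\<bar>)"
    by (intro mult_left_mono exp_minus_one_le_C_const) auto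
  also have "\<dots> = C_const M * (\<epsilon> * M)\<^sup>2 * (\<bar>?Z\<bar> / ?d)"
    by (simp add: inner_sign_mean abs_mult power_mult_distrib)
  finally have "n * (\<epsilon>\<^sup>2 * (exp ?x - 1)) \<le> n * (C_const M * (\<epsilon> * M)\<^sup>2 * (\<bar>?Z\<bar> / ?d))"
    by (intro mult_left_mono) auto
  also have "\<dots> \<le> n * (C_const M * (rho_sharp M CARD('d) n)\<^sup>2 * (\<bar>?Z\<bar> / ?d))"
    using \<rho> \<epsilon> M C_const_ge_1[of M]
    by (intro mult_left_mono mult_right_mono power_mono) auto
  also have "\<dots> = (n * C_const M * (rho_sharp M CARD('d) n)\<^sup>2) * (\<bar>?Z\<bar> / ?d)" by simp
  also have "\<dots> = \<bar>?Z\<bar> / (4 * sqrt ?d)"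
    unfolding rho_sharp_square[OF n] using d real_sqrt_mult_self[of ?d]
    by (simp add: field_simps del: real_sqrt_mult_self)
  finally have *: "n * (\<epsilon>\<^sup>2 * (exp ?x - 1)) \<le> \<bar>?Z\<bar> / (4 * sqrt ?d)" .
  (* The base of the power must be nonnegative before it can be compared with exp; this is
     where \<epsilon> \<le> 1 enters. *)
  have e2: "\<epsilon>\<^sup>2 \<le> 1" using \<epsilon> by (simp add: power_le_one)
  have "0 \<le> (1 - \<epsilon>\<^sup>2) + \<epsilon>\<^sup>2 * exp ?x" using e2 by (intro add_nonneg_nonneg) auto
  then have "0 \<le> 1 + \<epsilon>\<^sup>2 * (exp ?x - 1)" by (simp add: algebra_simps)
  then have "(1 + \<epsilon>\<^sup>2 * (exp ?x - 1)) ^ n \<le> exp (\<epsilon>\<^sup>2 * (exp ?x - 1)) ^ n"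
    by (intro power_mono exp_ge_add_one_self)
  also have "\<dots> = exp (n * (\<epsilon>\<^sup>2 * (exp ?x - 1)))" by (simp add: exp_of_nat_mult)
  also have "\<dots> \<le> exp (\<bar>?Z\<bar> / (4 * sqrt ?d))" using * by simp
  finally show ?thesis .
qed

text \<open>
  The second moment method bounds the average over the vertices of the cube, and some vertex does
  at least as well as the average.
\<close>

lemma exists_hard_sign_mean:
  fixes A :: "(nat \<Rightarrow> real ^ 'd::finite) set"
  assumes A: "A \<in> sets (sample_law n (gaussian_density :: real ^ 'd \<Rightarrow> real))"
    and M: "M > 0" and n: "n \<ge> 1" and \<epsilon>: "0 \<le> \<epsilon>" "\<epsilon> \<le> 1"
    and \<rho>: "\<epsilon> * M \<le> rho_sharp M CARD('d) n"
  obtains g :: "'d \<Rightarrow> real" where "g \<in> sign_patterns"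
    "measure (sample_law n (mixture_density \<epsilon> (sign_mean M g))) A
      \<ge> measure (sample_law n gaussian_density) A - 0.575"
proof -
  let ?S = "sign_patterns :: ('d \<Rightarrow> real) set"
  let ?P = "sample_law n (gaussian_density :: real ^ 'd \<Rightarrow> real)"
  let ?h = "\<lambda>g. sample_likelihood_ratio n \<epsilon> (sign_mean M g)"
  let ?c = "\<lambda>g h. (1 + \<epsilon>\<^sup>2 * (exp (sign_mean M g \<bullet> sign_mean M h) - 1)) ^ n"
  let ?p = "\<lambda>g. measure (sample_law n (mixture_density \<epsilon> (sign_mean M g))) A"
  have P: "prob_space ?P"
    unfolding sample_law_def by (intro prob_space_PiM prob_space_std_gaussian)
  have card: "real (card ?S) = 2 ^ CARD('d)" by (simp add: card_sign_patterns)
  then have ne: "?S \<noteq> {}" by auto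
  have "(\<Sum>g\<in>?S. measure (density ?P (?h g)) A) / card ?S
      \<ge> measure ?P A - (\<Sum>g\<in>?S. \<Sum>h\<in>?S. ?c g h) / (real (card ?S))\<^sup>2 / 4"
  proof (rule average_prob_ge_second_moment[OF P A finite_sign_patterns ne])
    fix g :: "'d \<Rightarrow> real" and x
    show "0 \<le> ?h g x"
      using \<epsilon> by (auto simp: sample_likelihood_ratio_def intro!: prod_nonneg likelihood_ratio_nonneg)
  next
    fix g :: "'d \<Rightarrow> real"
    show "has_bochner_integral ?P (?h g) 1"
      using has_bochner_integral_sample_law_prod[OF has_bochner_integral_likelihood_ratio, of n \<epsilon> "sign_mean M g"]
      by (simp add: sample_likelihood_ratio_def[abs_def])
  next
    fix g h :: "'d \<Rightarrow> real"
    show "has_bochner_integral ?P (\<lambda>x. ?h g x * ?h h x) (?c g h)"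
      using has_bochner_integral_sample_law_prod[OF has_bochner_integral_likelihood_ratio_mult,
          of n \<epsilon> "sign_mean M g" "sign_mean M h"]
      by (simp add: sample_likelihood_ratio_def[abs_def] prod.distrib)
  qed
  moreover have "(\<Sum>g\<in>?S. \<Sum>h\<in>?S. ?c g h) \<le> (\<Sum>g\<in>?S. 2.3 * 2 ^ CARD('d))"
  proof (rule sum_mono)
    fix g assume g: "g \<in> ?S"
    have "(\<Sum>h\<in>?S. ?c g h) \<le> (\<Sum>h\<in>?S. exp (\<bar>\<Sum>i\<in>UNIV. g i * h i\<bar> / (4 * sqrt CARD('d))))"
      using sign_mean_second_moment_le[OF g _ M n \<epsilon> \<rho>] by (intro sum_mono) auto
    also have "\<dots> \<le> 2.3 * 2 ^ CARD('d)" by (rule sum_exp_abs_sign_patterns_le[OF g])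
    finally show "(\<Sum>h\<in>?S. ?c g h) \<le> 2.3 * 2 ^ CARD('d)" .
  qed
  then have "(\<Sum>g\<in>?S. \<Sum>h\<in>?S. ?c g h) / (real (card ?S))\<^sup>2 \<le> 2.3"
    by (simp add: card power2_eq_square field_simps)
  ultimately have "(\<Sum>g\<in>?S. ?p g) / card ?S \<ge> measure ?P A - 0.575"
    by (simp add: sample_law_mixture[OF \<epsilon>])
  then have "(\<Sum>g\<in>?S. ?p g) \<ge> (\<Sum>g\<in>?S. measure ?P A - 0.575)"
    by (simp add: card field_simps)
  then obtain g where "g \<in> ?S" "?p g \<ge> measure ?P A - 0.575"
    using ne finite_sign_patterns
    by (metis (no_types, lifting) sum_strict_mono linorder_not_le)
  then show thesis by (rule that)
qed

section \<open>The minimax lower bound\<close>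

lemma level_test_null_acceptance:
  assumes "\<Psi> \<in> level_tests n \<alpha>"
  shows "{x \<in> space (sample_law n gaussian_density). \<Psi> x = 0} \<in> sets (sample_law n gaussian_density)"
    and "\<P>(x in sample_law n gaussian_density. \<Psi> x = 0) \<ge> 1 - \<alpha>"
proof -
  let ?P = "sample_law n gaussian_density"
  interpret prob_space ?P
    unfolding sample_law_def by (intro prob_space_PiM prob_space_std_gaussian)
  have "sets ?P = sets (\<Pi>\<^sub>M i\<in>{1..n}. borel)"
    unfolding sample_law_def by (intro sets_PiM_cong) auto
  then have \<Psi>[measurable]: "\<Psi> \<in> ?P \<rightarrow>\<^sub>M count_space {0, 1}"
    using assms measurable_cong_sets[of ?P "\<Pi>\<^sub>M i\<in>{1..n}. borel"] by (auto simp: level_tests_def tests_def)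
  show A: "{x \<in> space ?P. \<Psi> x = 0} \<in> events" by measurable
  have "{x \<in> space ?P. \<Psi> x = 1} = space ?P - {x \<in> space ?P. \<Psi> x = 0}"
    using measurable_space[OF \<Psi>] by fastforce
  then have "\<P>(x in ?P. \<Psi> x = 1) = 1 - \<P>(x in ?P. \<Psi> x = 0)"
    using prob_compl[OF A] by simp
  then show "\<P>(x in ?P. \<Psi> x = 0) \<ge> 1 - \<alpha>" using assms by (simp add: level_tests_def)
qed

lemma max_type2_error_ge:
  fixes \<Psi> :: "(nat \<Rightarrow> real ^ 'd::finite) \<Rightarrow> nat"
  assumes \<Psi>: "\<Psi> \<in> level_tests n \<alpha>" and M: "M > 0" and n: "n \<ge> 1"
    and \<rho>: "\<rho> < rho_sharp M CARD('d) n" "\<rho> < M"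
  shows "max_type2_error n (F2 M) \<Psi> \<rho> \<ge> ennreal (0.425 - \<alpha>)"
proof -
  (* A lower bound \<rho> may be nonpositive, but the weight \<epsilon> of an alternative must be positive;
     raising \<rho> to some r > 0 that still satisfies both upper bounds only shrinks the alternatives. *)
  define r where "r = max \<rho> (min (rho_sharp M CARD('d) n) M / 2)"
  have pos: "rho_sharp M CARD('d) n > 0" using n by (intro rho_sharp_pos) (auto simp: Suc_leI)
  have r: "0 < r" "r < M" "r \<le> rho_sharp M CARD('d) n" "\<rho> \<le> r"
    using pos M \<rho> by (auto simp: r_def)
  define \<epsilon> where "\<epsilon> = r / M"
  have \<epsilon>: "0 < \<epsilon>" "\<epsilon> < 1" "\<epsilon> * M = r" using r M by (auto simp: \<epsilon>_def)
  let ?A = "{x \<in> space (sample_law n (gaussian_density :: real ^ 'd \<Rightarrow> real)). \<Psi> x = 0}"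
  obtain g :: "'d \<Rightarrow> real" where g: "g \<in> sign_patterns"
    "measure (sample_law n (mixture_density \<epsilon> (sign_mean M g))) ?A
      \<ge> measure (sample_law n gaussian_density) ?A - 0.575"
    using exists_hard_sign_mean[OF level_test_null_acceptance(1)[OF \<Psi>] M n, of \<epsilon>] \<epsilon> r by auto
  have sep: "(\<epsilon>, sign_mean M g) \<in> separated (F2 M) \<rho>"
    using \<epsilon> r M by (simp add: separated_def F2_def norm_sign_mean g(1))
  have "space (sample_law n (mixture_density \<epsilon> (sign_mean M g)))
      = space (sample_law n (gaussian_density :: real ^ 'd \<Rightarrow> real))"
    by (simp add: sample_law_def space_PiM)
  then have "ennreal (0.425 - \<alpha>)
      \<le> ennreal (\<P>(x in sample_law n (mixture_density \<epsilon> (sign_mean M g)). \<Psi> x = 0))"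
    using g(2) level_test_null_acceptance(2)[OF \<Psi>] by (intro ennreal_leI) simp
  also have "\<dots> \<le> max_type2_error n (F2 M) \<Psi> \<rho>"
    unfolding max_type2_error_def by (rule SUP_upper2[OF sep]) simp
  finally show ?thesis .
qed

theorem theorem2:
  fixes M \<alpha> \<beta> :: real and n :: nat
  assumes "M > 0" and "n \<ge> 1"
    and "0 < \<alpha>" and "\<alpha> < 1" and "0 < \<beta>" and "\<beta> < 1" and "\<alpha> + \<beta> < 0.29"
  shows "(\<forall>\<rho>. \<rho> < rho_sharp M CARD('d::finite) n \<and>
              separated (F2 M :: (real \<times> (real ^ 'd)) set) \<rho> \<noteq> {} \<longrightarrow>
            (INF \<Psi>\<in>level_tests n \<alpha>.
               max_type2_error n (F2 M :: (real \<times> (real ^ 'd)) set) \<Psi> \<rho>) > ennreal \<beta>)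
       \<and> (rho_sharp M CARD('d) n \<le> M \<longrightarrow>
            minimax_rate n (F2 M :: (real \<times> (real ^ 'd)) set) \<alpha> \<beta> \<ge> ennreal (rho_sharp M CARD('d) n))"
proof (intro conjI allI impI)
  have gap: "ennreal \<beta> < ennreal (0.425 - \<alpha>)" using assms by (intro ennreal_lessI) auto
  {
    (* Nonemptiness of the alternatives is needed precisely to get \<rho> < M: then the weight
       \<rho> / M is admissible. *)
    fix \<rho> assume \<rho>: "\<rho> < rho_sharp M CARD('d) n \<and> separated (F2 M :: (real \<times> (real ^ 'd)) set) \<rho> \<noteq> {}"
    then obtain \<epsilon> and \<mu> :: "real ^ 'd" where
      "0 < \<epsilon>" "\<epsilon> < 1" "norm \<mu> \<le> M" "\<rho> \<le> \<epsilon> * norm \<mu>"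
      by (auto simp: separated_def F2_def)
    moreover have "\<epsilon> * norm \<mu> \<le> \<epsilon> * M" "\<epsilon> * M < 1 * M"
      using calculation assms(1) by (auto intro: mult_left_mono mult_strict_right_mono)
    ultimately have "\<rho> < M" by linarith
    then have "ennreal (0.425 - \<alpha>) \<le> (INF \<Psi>\<in>level_tests n \<alpha>.
        max_type2_error n (F2 M :: (real \<times> (real ^ 'd)) set) \<Psi> \<rho>)"
      using \<rho> assms by (intro INF_greatest max_type2_error_ge) auto
    with gap show "(INF \<Psi>\<in>level_tests n \<alpha>.
        max_type2_error n (F2 M :: (real \<times> (real ^ 'd)) set) \<Psi> \<rho>) > ennreal \<beta>"
      by (rule less_le_trans)
  }
  assume le: "rho_sharp M CARD('d) n \<le> M"
  show "minimax_rate n (F2 M :: (real \<times> (real ^ 'd)) set) \<alpha> \<beta> \<ge> ennreal (rho_sharp M CARD('d) n)"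
    unfolding minimax_rate_def uniform_separation_def
  proof (intro INF_greatest ennreal_leI)
    fix \<Psi> :: "(nat \<Rightarrow> real ^ 'd) \<Rightarrow> nat" and \<rho>
    assume \<Psi>: "\<Psi> \<in> level_tests n \<alpha>"
      and \<rho>: "\<rho> \<in> {\<rho>. 0 < \<rho> \<and> max_type2_error n (F2 M) \<Psi> \<rho> \<le> ennreal \<beta>}"
    show "rho_sharp M CARD('d) n \<le> \<rho>"
    proof (rule ccontr)
      assume "\<not> rho_sharp M CARD('d) n \<le> \<rho>"
      then have "ennreal (0.425 - \<alpha>) \<le> max_type2_error n (F2 M) \<Psi> \<rho>"
        using le assms by (intro max_type2_error_ge[OF \<Psi>]) auto
      then have "ennreal \<beta> < max_type2_error n (F2 M) \<Psi> \<rho>" using gap by (rule less_le_trans[rotated])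
      then show False using \<rho> by auto
    qed
  qed
qed

end
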